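(* Let $G$ be a unimodular connected Lie group with Haar measure $dx$, let $\mathbb{X}=\{X_1,\dots,X_k\}$ be a family of left-invariant vector fields on $G$ satisfying the Hörmander condition, let $|\cdot|$ and $V$ be the associated Carnot–Carathéodory distance to the neutral element and volume function, let $s\in(0,1)$, and for $u:G\to\mathbb{R}$ let $$\mathcal{L}u(x)=\int_G\frac{u(x)-u(y)}{V(|y^{-1}x|)\,|y^{-1}x|^{2s}}\,dy .$$ Let $\varphi:\mathbb{R}\to\mathbb{R}$ be a convex function of class $C^2$, let $u:G\to\mathbb{R}$, and let $x\in G$ be a point at which $\mathcal{L}u(x)$ and $\mathcal{L}(\varphi\circ u)(x)$ exist. Then $$\mathcal{L}(\varphi\circ u)(x)\;\le\;\varphi'(u(x))\,\mathcal{L}u(x).$$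
   Context: Unimodular means that the Haar measure is left- and right-invariant. The Hörmander condition means that the Lie algebra of $G$ is generated, as a Lie algebra, by $X_1,\dots,X_k$. An absolutely continuous path $\ell:[0,1]\to G$ is admissible if there are measurable functions $a_1,\dots,a_k$ on $[0,1]$ with $\ell'(t)=\sum_{i=1}^ka_i(t)X_i(\ell(t))$ for a.e. $t$; its length is $\int_0^1\left(\sum_{i=1}^k|a_i(t)|^2\right)^{1/2}dt$. The Carnot–Carathéodory distance $d(x,y)$ is the infimum of the lengths of admissible paths joining $x$ to $y$; it is left-invariant. Write $|x|=d(e,x)$, with $e$ the neutral element, so that $d(x,y)=|y^{-1}x|$. For $r>0$, $V(r)$ is the Haar measure of any open ball of radius $r$ for $d$. No assumption is made on the volume growth of $G$. The integral defining $\mathcal{L}u(x)$ is understood in the principal value sense, i.e. as the limit as $\varepsilon\to0^+$ of the (absolutely convergent) integrals over $\{y\in G:|y^{-1}x|>\varepsilon\}$; "exist" means that these truncated integrals converge absolutely and have a finite limit. *)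

theory Defs
  imports "HOL-Analysis.Analysis"
begin

section \<open>Maps of class C^k\<close>

text \<open>The set \<open>S\<close> is meant to be open and the domain finite-dimensional; then continuity of all
  iterated directional derivatives up to order \<open>n\<close> is the usual notion of class C^n.\<close>

fun Ck_on :: "nat \<Rightarrow> 'a::real_normed_vector set \<Rightarrow> ('a \<Rightarrow> 'b::real_normed_vector) \<Rightarrow> bool" where
  "Ck_on 0 S f \<longleftrightarrow> continuous_on S f"
| "Ck_on (Suc n) S f \<longleftrightarrow>
     (\<forall>x\<in>S. f differentiable (at x)) \<and> (\<forall>v. Ck_on n S (\<lambda>x. frechet_derivative f (at x) v))"

definition smooth_on :: "'a::real_normed_vector set \<Rightarrow> ('a \<Rightarrow> 'b::real_normed_vector) \<Rightarrow> bool" where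
  "smooth_on S f \<longleftrightarrow> (\<forall>n. Ck_on n S f)"

section \<open>Lie groups\<close>

text \<open>Groups are written additively, because \<^class>\<open>topological_group_add\<close> is the library's class of
  topological groups; it does not assume commutativity. The neutral element is \<open>0\<close>, and the product
  of the inverse of \<open>y\<close> with \<open>x\<close> is \<open>- y + x\<close>.

  A chart is a pair \<open>(U, c)\<close> whose inverse is \<open>inv_into U c\<close>. The model space is a
  finite-dimensional normed space rather than a \<^class>\<open>euclidean_space\<close>, because the latter excludes
  dimension 0.\<close>

type_synonym ('g, 'e) atlas = "('g set \<times> ('g \<Rightarrow> 'e)) set"

definition smooth_atlas :: "('g::topological_space, 'e::real_normed_vector) atlas \<Rightarrow> bool" where
  "smooth_atlas A \<longleftrightarrow>
     (\<exists>B::'e set. finite B \<and> span B = UNIV) \<and>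
     (\<Union>(U, c)\<in>A. U) = UNIV \<and>
     (\<forall>(U, c)\<in>A. open U \<and> open (c ` U) \<and> homeomorphism U (c ` U) c (inv_into U c)) \<and>
     (\<forall>(U, c)\<in>A. \<forall>(V, d)\<in>A. smooth_on (c ` (U \<inter> V)) (d \<circ> inv_into U c))"

definition lie_group ::
  "('g::{topological_group_add, t2_space, second_countable_topology}, 'e::real_normed_vector) atlas \<Rightarrow> bool"
where
  "lie_group A \<longleftrightarrow>
     smooth_atlas A \<and>
     (\<forall>(U, c)\<in>A. \<forall>(V, d)\<in>A. \<forall>(W, h)\<in>A.
        smooth_on {(p, q). p \<in> c ` U \<and> q \<in> d ` V \<and> inv_into U c p + inv_into V d q \<in> W}
          (\<lambda>(p, q). h (inv_into U c p + inv_into V d q))) \<and>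
     (\<forall>(U, c)\<in>A. \<forall>(V, d)\<in>A.
        smooth_on {p. p \<in> c ` U \<and> - inv_into U c p \<in> V} (\<lambda>p. d (- inv_into U c p)))"

section \<open>Vector fields and the Hoermander condition\<close>

definition smooth_functions :: "('g::topological_space, 'e::real_normed_vector) atlas \<Rightarrow> ('g \<Rightarrow> real) set" where
  "smooth_functions A = {f. \<forall>(U, c)\<in>A. smooth_on (c ` U) (f \<circ> inv_into U c)}"

text \<open>Smooth vector fields are the derivations of the algebra of smooth functions. Their value on
  nonsmooth functions is fixed to be 0, so that fields are equal as soon as they agree on
  smooth functions.\<close>

type_synonym 'g vfield = "('g \<Rightarrow> real) \<Rightarrow> ('g \<Rightarrow> real)"

definition vector_fields :: "('g::topological_space, 'e::real_normed_vector) atlas \<Rightarrow> 'g vfield set" where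
  "vector_fields A = {Y.
     (\<forall>f. f \<notin> smooth_functions A \<longrightarrow> Y f = (\<lambda>x. 0)) \<and>
     (\<forall>f\<in>smooth_functions A. Y f \<in> smooth_functions A) \<and>
     (\<forall>f\<in>smooth_functions A. \<forall>g\<in>smooth_functions A. \<forall>a b.
        Y (\<lambda>x. a * f x + b * g x) = (\<lambda>x. a * Y f x + b * Y g x)) \<and>
     (\<forall>f\<in>smooth_functions A. \<forall>g\<in>smooth_functions A.
        Y (\<lambda>x. f x * g x) = (\<lambda>x. Y f x * g x + f x * Y g x))}"

definition lie_algebra :: "('g::topological_group_add, 'e::real_normed_vector) atlas \<Rightarrow> 'g vfield set" where
  "lie_algebra A = {Y \<in> vector_fields A.
     \<forall>g. \<forall>f\<in>smooth_functions A. Y (\<lambda>x. f (g + x)) = (\<lambda>x. Y f (g + x))}"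

definition lie_bracket :: "'g vfield \<Rightarrow> 'g vfield \<Rightarrow> 'g vfield" where
  "lie_bracket Y Z = (\<lambda>f x. Y (Z f) x - Z (Y f) x)"

inductive_set lie_generated :: "'g vfield set \<Rightarrow> 'g vfield set" for S where
  generator: "Y \<in> S \<Longrightarrow> Y \<in> lie_generated S"
| zero: "(\<lambda>f x. 0) \<in> lie_generated S"
| add: "Y \<in> lie_generated S \<Longrightarrow> Z \<in> lie_generated S \<Longrightarrow> (\<lambda>f x. Y f x + Z f x) \<in> lie_generated S"
| scale: "Y \<in> lie_generated S \<Longrightarrow> (\<lambda>f x. r * Y f x) \<in> lie_generated S"
| bracket: "Y \<in> lie_generated S \<Longrightarrow> Z \<in> lie_generated S \<Longrightarrow> lie_bracket Y Z \<in> lie_generated S"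

definition hoermander :: "('g::topological_group_add, 'e::real_normed_vector) atlas \<Rightarrow>
    (nat \<Rightarrow> 'g vfield) \<Rightarrow> nat \<Rightarrow> bool" where
  "hoermander A X k \<longleftrightarrow> lie_generated (X ` {1..k}) = lie_algebra A"

section \<open>The Carnot-Caratheodory distance\<close>

definition abs_cont_on :: "real \<Rightarrow> real \<Rightarrow> (real \<Rightarrow> 'e::metric_space) \<Rightarrow> bool" where
  "abs_cont_on a b f \<longleftrightarrow>
     (\<forall>\<epsilon>>0. \<exists>\<delta>>0. \<forall>D. finite D \<and> (\<forall>(p, q)\<in>D. a \<le> p \<and> p \<le> q \<and> q \<le> b) \<and>
        pairwise (\<lambda>(p, q) (p', q'). {p<..<q} \<inter> {p'<..<q'} = {}) D \<and>
        (\<Sum>(p, q)\<in>D. q - p) < \<delta> \<longrightarrow> (\<Sum>(p, q)\<in>D. dist (f p) (f q)) < \<epsilon>)"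

definition abs_cont_path :: "('g::topological_space, 'e::real_normed_vector) atlas \<Rightarrow> (real \<Rightarrow> 'g) \<Rightarrow> bool" where
  "abs_cont_path A l \<longleftrightarrow> continuous_on {0..1} l \<and>
     (\<forall>(U, c)\<in>A. \<forall>a b. 0 \<le> a \<and> a \<le> b \<and> b \<le> 1 \<and> l ` {a..b} \<subseteq> U \<longrightarrow> abs_cont_on a b (c \<circ> l))"

text \<open>The velocity of \<open>l\<close> at \<open>t\<close> is the tangent vector sending a smooth \<open>f\<close> to the derivative of
  \<open>f \<circ> l\<close> at \<open>t\<close>. The controls \<open>a\<close> are part of the data since they are not determined by \<open>l\<close> when
  the fields are linearly dependent.\<close>

definition admissible :: "('g::topological_space, 'e::real_normed_vector) atlas \<Rightarrow>
    (nat \<Rightarrow> 'g vfield) \<Rightarrow> nat \<Rightarrow> (real \<Rightarrow> 'g) \<Rightarrow> (nat \<Rightarrow> real \<Rightarrow> real) \<Rightarrow> bool" where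
  "admissible A X k l a \<longleftrightarrow> abs_cont_path A l \<and>
     (\<forall>i\<in>{1..k}. a i \<in> borel_measurable (lebesgue_on {0..1})) \<and>
     (AE t in lebesgue_on {0..1}. \<forall>f\<in>smooth_functions A.
        ((\<lambda>\<tau>. f (l \<tau>)) has_real_derivative (\<Sum>i=1..k. a i t * X i f (l t))) (at t within {0..1}))"

definition path_len :: "nat \<Rightarrow> (nat \<Rightarrow> real \<Rightarrow> real) \<Rightarrow> ennreal" where
  "path_len k a = (\<integral>\<^sup>+ t. ennreal (sqrt (\<Sum>i=1..k. \<bar>a i t\<bar>\<^sup>2)) \<partial>lebesgue_on {0..1})"

definition cc_dist :: "('g::topological_space, 'e::real_normed_vector) atlas \<Rightarrow>
    (nat \<Rightarrow> 'g vfield) \<Rightarrow> nat \<Rightarrow> 'g \<Rightarrow> 'g \<Rightarrow> real" where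
  "cc_dist A X k x y =
     enn2real (Inf {path_len k a | l a. admissible A X k l a \<and> l 0 = x \<and> l 1 = y})"

definition cc_norm :: "('g::topological_group_add, 'e::real_normed_vector) atlas \<Rightarrow>
    (nat \<Rightarrow> 'g vfield) \<Rightarrow> nat \<Rightarrow> 'g \<Rightarrow> real" where
  "cc_norm A X k x = cc_dist A X k 0 x"

section \<open>Haar measure and the operator\<close>

text \<open>Regularity of \<open>\<mu>\<close> need not be required: it is automatic on a second countable locally compact
  Hausdorff space.\<close>

definition haar_measure :: "'g::topological_group_add measure \<Rightarrow> bool" where
  "haar_measure \<mu> \<longleftrightarrow> sets \<mu> = sets borel \<and> emeasure \<mu> UNIV \<noteq> 0 \<and>
     (\<forall>K. compact K \<longrightarrow> emeasure \<mu> K < \<infinity>) \<and>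
     (\<forall>g. \<forall>S\<in>sets borel. emeasure \<mu> ((\<lambda>x. g + x) ` S) = emeasure \<mu> S)"

definition right_invariant :: "'g::topological_group_add measure \<Rightarrow> bool" where
  "right_invariant \<mu> \<longleftrightarrow> (\<forall>g. \<forall>S\<in>sets borel. emeasure \<mu> ((\<lambda>x. x + g) ` S) = emeasure \<mu> S)"

definition volume :: "('g::topological_group_add, 'e::real_normed_vector) atlas \<Rightarrow>
    (nat \<Rightarrow> 'g vfield) \<Rightarrow> nat \<Rightarrow> 'g measure \<Rightarrow> real \<Rightarrow> real" where
  "volume A X k \<mu> r = measure \<mu> {y. cc_dist A X k 0 y < r}"

definition integrand :: "('g::topological_group_add, 'e::real_normed_vector) atlas \<Rightarrow>
    (nat \<Rightarrow> 'g vfield) \<Rightarrow> nat \<Rightarrow> 'g measure \<Rightarrow> real \<Rightarrow> ('g \<Rightarrow> real) \<Rightarrow> 'g \<Rightarrow> 'g \<Rightarrow> real" where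
  "integrand A X k \<mu> s u x y =
     (u x - u y) / (volume A X k \<mu> (cc_norm A X k (- y + x)) * cc_norm A X k (- y + x) powr (2 * s))"

definition L_trunc :: "('g::topological_group_add, 'e::real_normed_vector) atlas \<Rightarrow>
    (nat \<Rightarrow> 'g vfield) \<Rightarrow> nat \<Rightarrow> 'g measure \<Rightarrow> real \<Rightarrow> ('g \<Rightarrow> real) \<Rightarrow> 'g \<Rightarrow> real \<Rightarrow> real" where
  "L_trunc A X k \<mu> s u x \<epsilon> =
     (LINT y:{y. cc_norm A X k (- y + x) > \<epsilon>}|completion \<mu>. integrand A X k \<mu> s u x y)"

text \<open>Integrals are taken with respect to the completion, so that integrands need only be measurable
  up to a null set; for Borel functions nothing changes.\<close>

definition L_exists :: "('g::topological_group_add, 'e::real_normed_vector) atlas \<Rightarrow>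
    (nat \<Rightarrow> 'g vfield) \<Rightarrow> nat \<Rightarrow> 'g measure \<Rightarrow> real \<Rightarrow> ('g \<Rightarrow> real) \<Rightarrow> 'g \<Rightarrow> bool" where
  "L_exists A X k \<mu> s u x \<longleftrightarrow>
     (\<forall>\<epsilon>>0. set_integrable (completion \<mu>) {y. cc_norm A X k (- y + x) > \<epsilon>} (integrand A X k \<mu> s u x)) \<and>
     (\<exists>L. (L_trunc A X k \<mu> s u x \<longlongrightarrow> L) (at_right 0))"

definition L_op :: "('g::topological_group_add, 'e::real_normed_vector) atlas \<Rightarrow>
    (nat \<Rightarrow> 'g vfield) \<Rightarrow> nat \<Rightarrow> 'g measure \<Rightarrow> real \<Rightarrow> ('g \<Rightarrow> real) \<Rightarrow> 'g \<Rightarrow> real" where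
  "L_op A X k \<mu> s u x = Lim (at_right 0) (L_trunc A X k \<mu> s u x)"

end

theory Submission
  imports Defs
begin

text \<open>A convex function lies above its tangent at \<open>u x\<close>, which rearranges to
  \<phi>(u x) - \<phi>(u y) \<le> \<phi>'(u x) (u x - u y) for every \<open>y\<close>. Since the
  kernel is nonnegative, the two integrands are ordered pointwise in the same way
  (\<open>integrand_convex_le\<close>). Integrating over the region where \<open>cc_norm\<close>
  exceeds \<epsilon> orders the truncated integrals, and the order survives the limit \<epsilon>
  \<rightarrow> 0 (\<open>L_trunc_tendsto_L_op\<close>).\<close>

lemma integrand_convex_le:
  fixes \<phi> :: "real \<Rightarrow> real"
  assumes "convex_on UNIV \<phi>" and "\<phi> differentiable (at (u x))"
  shows "integrand A X k \<mu> s (\<phi> \<circ> u) x y \<le> deriv \<phi> (u x) * integrand A X k \<mu> s u x y"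
proof -
  have "(\<phi> has_real_derivative deriv \<phi> (u x)) (at (u x))"
    using assms(2) by (simp add: DERIV_deriv_iff_real_differentiable)
  then have "\<phi> (u y) - \<phi> (u x) \<ge> deriv \<phi> (u x) * (u y - u x)"
    by (intro convex_on_imp_above_tangent[OF assms(1)]) auto
  then have "\<phi> (u x) - \<phi> (u y) \<le> deriv \<phi> (u x) * (u x - u y)"
    by (simp add: algebra_simps)
  \<comment> \<open>Nonnegativity of the denominator is enough: where it vanishes, for instance at
    \<open>y = x\<close>, both quotients are 0 by the convention for division by zero.\<close>
  then show ?thesis
    unfolding integrand_def volume_def times_divide_eq_right comp_apply
    by (rule divide_right_mono) (simp add: measure_nonneg)
qed

text \<open>\<open>Lim\<close> is a definite description, so \<open>L_op\<close> means something
  only once a limit is known to exist. Existence comes from \<open>L_exists\<close>, and uniqueness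
  from \<open>at_right 0\<close> being a nontrivial filter.\<close>

lemma L_trunc_tendsto_L_op:
  assumes "L_exists A X k \<mu> s u x"
  shows "(L_trunc A X k \<mu> s u x \<longlongrightarrow> L_op A X k \<mu> s u x) (at_right 0)"
  using assms tendsto_Lim[OF trivial_limit_at_right_real]
  unfolding L_exists_def L_op_def by metis

theorem mainTheorem6:
  fixes A :: "('g::{topological_group_add, t2_space, second_countable_topology}, 'e::real_normed_vector) atlas"
    and X :: "nat \<Rightarrow> 'g vfield" and k :: nat and \<mu> :: "'g measure" and s :: real
    and \<phi> :: "real \<Rightarrow> real" and u :: "'g \<Rightarrow> real" and x :: 'g
  assumes "lie_group A"
    and "connected (UNIV :: 'g set)"
    and "haar_measure \<mu>" and "right_invariant \<mu>"
    and "\<forall>i\<in>{1..k}. X i \<in> lie_algebra A"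
    and "hoermander A X k"
    and "0 < s" and "s < 1"
    and "convex_on UNIV \<phi>" and "Ck_on 2 UNIV \<phi>"
    and "L_exists A X k \<mu> s u x"
    and "L_exists A X k \<mu> s (\<phi> \<circ> u) x"
  shows "L_op A X k \<mu> s (\<phi> \<circ> u) x \<le> deriv \<phi> (u x) * L_op A X k \<mu> s u x"
proof -
  have diff: "\<phi> differentiable (at (u x))"
    using \<open>Ck_on 2 UNIV \<phi>\<close> by (simp add: numeral_2_eq_2)
  have trunc: "L_trunc A X k \<mu> s (\<phi> \<circ> u) x \<epsilon> \<le> deriv \<phi> (u x) * L_trunc A X k \<mu> s u x \<epsilon>"
    if "\<epsilon> > 0" for \<epsilon>
  proof -
    let ?S = "{y. cc_norm A X k (- y + x) > \<epsilon>}"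
    have "set_integrable (completion \<mu>) ?S (integrand A X k \<mu> s u x)"
      and int_phi: "set_integrable (completion \<mu>) ?S (integrand A X k \<mu> s (\<phi> \<circ> u) x)"
      using assms(11,12) that unfolding L_exists_def by blast+
    then have "set_integrable (completion \<mu>) ?S (\<lambda>y. deriv \<phi> (u x) * integrand A X k \<mu> s u x y)"
      by simp
    \<comment> \<open>The factor \<phi>'(u x) does not depend on \<open>y\<close>, so it moves
      inside the integral whatever its sign, and monotonicity of the integral compares both sides on
      the same set.\<close>
    then show ?thesis
      unfolding L_trunc_def set_integral_mult_right[symmetric]
      using int_phi integrand_convex_le[where u = u and x = x, OF \<open>convex_on UNIV \<phi>\<close> diff]
      by (intro set_integral_mono) auto
  qed
  show ?thesis
  proof (rule tendsto_le[OF trivial_limit_at_right_real])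
    show "((\<lambda>\<epsilon>. deriv \<phi> (u x) * L_trunc A X k \<mu> s u x \<epsilon>)
        \<longlongrightarrow> deriv \<phi> (u x) * L_op A X k \<mu> s u x) (at_right 0)"
      by (intro tendsto_mult_left L_trunc_tendsto_L_op assms(11))
    show "(L_trunc A X k \<mu> s (\<phi> \<circ> u) x \<longlongrightarrow> L_op A X k \<mu> s (\<phi> \<circ> u) x) (at_right 0)"
      by (intro L_trunc_tendsto_L_op assms(12))
    show "\<forall>\<^sub>F \<epsilon> in at_right 0.
        L_trunc A X k \<mu> s (\<phi> \<circ> u) x \<epsilon> \<le> deriv \<phi> (u x) * L_trunc A X k \<mu> s u x \<epsilon>"
      using trunc by (simp add: eventually_at_filter)
  qed
qed

end
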